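(* Let $d\ge2$. For every $\beta\in\Delta_3^{d-2}$ and $i\in[3]$, the ray $\mathbb R_{\ge0}\,g_{\beta,i}$ is an exposed extreme ray of the cone $\operatorname{BR}(\mathcal L_{3,d}^+)\subseteq\mathbb R^{\Delta_3^d}$. Consequently, $\operatorname{BR}(\mathcal L_{3,d}^+)$ has exactly $3\binom d2$ extreme rays, and $\{g_{\beta,i}:\beta\in\Delta_3^{d-2},\,i\in[3]\}$ is a minimal generating set of this cone.
   Context: $\mathbb N=\mathbb Z_{\ge0}$, $\Delta_3^d=\{\alpha\in\mathbb N^3:\alpha_1+\alpha_2+\alpha_3=d\}$, $e_1,e_2,e_3$ is the standard basis of $\mathbb R^3$, $[3]=\{1,2,3\}$, $\alpha!=\alpha_1!\alpha_2!\alpha_3!$, $\mathbf x^\alpha=x_1^{\alpha_1}x_2^{\alpha_2}x_3^{\alpha_3}$. $\mathcal L_{3,d}^+$ is the set of full-support Lorentzian polynomials of degree $d$ in three variables: polynomials $f=\sum_{\alpha\in\Delta_3^d}c_\alpha\mathbf x^\alpha/\alpha!$ with all $c_\alpha>0$ such that for every $\beta\in\Delta_3^{d-2}$ the symmetric matrix $(c_{\beta+e_i+e_j})_{1\le i,j\le3}$ has at most one positive eigenvalue. $\operatorname{BR}(\mathcal L_{3,d}^+)=\{w\in\mathbb R^{\Delta_3^d}:\sup_{f\in\mathcal L_{3,d}^+}\prod_{\alpha}c_\alpha^{w_\alpha}<\infty\}$, a convex cone. With $\varepsilon_\alpha$ the standard basis of $\mathbb R^{\Delta_3^d}$ and $\{i,j,k\}=\{1,2,3\}$,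 $g_{\beta,i}=\varepsilon_{\beta+2e_i}+\varepsilon_{\beta+e_j+e_k}-\varepsilon_{\beta+e_i+e_j}-\varepsilon_{\beta+e_i+e_k}$. A ray $\mathbb R_{\ge0}g$ ($g\neq0$) of a convex cone $K$ is exposed if there is a linear functional that is nonpositive on $K$ and whose zero set in $K$ is exactly $\mathbb R_{\ge0}g$. *)

theory Defs
  imports "HOL-Analysis.Analysis" "HOL-Library.Function_Algebras" "HOL-Library.Poly_Mapping"
begin

text \<open>
  The library has no vector space structure on function spaces. With the pointwise one, the
  library's \<open>linear\<close>, \<open>convex_cone\<close>, \<open>hull\<close> and \<open>face_of\<close> apply to real-valued functions.
\<close>

instantiation "fun" :: (type, real_vector) real_vector
begin

definition scaleR_fun :: "real \<Rightarrow> ('a \<Rightarrow> 'b) \<Rightarrow> 'a \<Rightarrow> 'b"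
  where "scaleR_fun r f = (\<lambda>x. r *\<^sub>R f x)"

instance
  by standard (auto simp: scaleR_fun_def plus_fun_def fun_eq_iff scaleR_add_left scaleR_add_right)

end

section \<open>Rays of convex cones\<close>

definition ray :: "'a::real_vector \<Rightarrow> 'a set"
  where "ray g = {t *\<^sub>R g | t. t \<ge> 0}"

definition extreme_ray :: "'a::real_vector set \<Rightarrow> 'a set \<Rightarrow> bool"
  where "extreme_ray K R \<longleftrightarrow> (\<exists>g. g \<noteq> 0 \<and> R = ray g) \<and> R face_of K"

definition exposed_ray :: "'a::real_vector set \<Rightarrow> 'a set \<Rightarrow> bool"
  where "exposed_ray K R \<longleftrightarrow> (\<exists>g. g \<noteq> 0 \<and> R = ray g) \<and>
    (\<exists>l :: 'a \<Rightarrow> real. linear l \<and> (\<forall>x\<in>K. l x \<le> 0) \<and> {x\<in>K. l x = 0} = R)"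

definition minimal_generating_set :: "'a::real_vector set \<Rightarrow> 'a set \<Rightarrow> bool"
  where "minimal_generating_set K G \<longleftrightarrow>
    convex_cone hull G = K \<and> (\<forall>H. H \<subset> G \<longrightarrow> convex_cone hull H \<noteq> K)"

section \<open>Full-support Lorentzian polynomials in three variables\<close>

text \<open>
  Exponents are vectors in \<open>nat ^ 3\<close>, and a real polynomial in three variables is an element of
  the monoid algebra \<open>(nat ^ 3) \<Rightarrow>\<^sub>0 real\<close>, so \<open>Poly_Mapping.lookup f \<alpha>\<close> is the coefficient
  of \<open>x\<^sub>1^\<alpha>\<^sub>1 x\<^sub>2^\<alpha>\<^sub>2 x\<^sub>3^\<alpha>\<^sub>3\<close>. The index type \<open>3\<close> has exactly the elements
  \<open>1, 2, 3\<close> (with \<open>3 = 0\<close>).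
\<close>

definition simplex_pts :: "nat \<Rightarrow> (nat ^ 3) set"
  where "simplex_pts d = {\<alpha>. (\<Sum>i\<in>UNIV. \<alpha> $ i) = d}"

abbreviation unit_exp :: "3 \<Rightarrow> nat ^ 3"
  where "unit_exp i \<equiv> axis i 1"

text \<open>The coefficient \<open>c\<^sub>\<alpha>\<close> in the normalization \<open>f = (\<Sum>\<alpha>. c\<^sub>\<alpha> x^\<alpha> / \<alpha>!)\<close>.\<close>

definition ncoeff :: "((nat ^ 3) \<Rightarrow>\<^sub>0 real) \<Rightarrow> nat ^ 3 \<Rightarrow> real"
  where "ncoeff f \<alpha> = (\<Prod>i\<in>UNIV. fact (\<alpha> $ i)) * Poly_Mapping.lookup f \<alpha>"

definition charpoly :: "'a::comm_ring_1 ^ 'n ^ 'n \<Rightarrow> 'a poly"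
  where "charpoly A = det (mat [:0, 1:] - (\<chi> i j. [:A $ i $ j:]))"

text \<open>Eigenvalues are counted with multiplicity.\<close>

definition num_pos_eigenvalues :: "real ^ 'n ^ 'n \<Rightarrow> nat"
  where "num_pos_eigenvalues A = size (filter_mset (\<lambda>t. t > 0) (proots (charpoly A)))"

definition lorentzian_full_support :: "nat \<Rightarrow> ((nat ^ 3) \<Rightarrow>\<^sub>0 real) set"
  where "lorentzian_full_support d =
    {f. Poly_Mapping.keys f \<subseteq> simplex_pts d \<and> (\<forall>\<alpha>\<in>simplex_pts d. ncoeff f \<alpha> > 0) \<and>
        (\<forall>\<beta>\<in>simplex_pts (d - 2).
           num_pos_eigenvalues
             ((\<chi> i j. ncoeff f (\<beta> + unit_exp i + unit_exp j)) :: real ^ 3 ^ 3) \<le> 1)}"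

section \<open>Bounded ratios\<close>

text \<open>
  The space \<open>\<real>\<^bsup>\<Delta>\<^esup>\<close> with \<open>\<Delta> = simplex_pts d\<close> is rendered as the subspace of the functions
  on \<open>nat ^ 3\<close> that vanish outside \<open>\<Delta>\<close>. Every linear functional on this subspace
  is the restriction of one on the whole function space, so \<^const>\<open>exposed_ray\<close> does not depend
  on the ambient space.
\<close>

definition bounded_ratios :: "nat \<Rightarrow> ((nat ^ 3) \<Rightarrow>\<^sub>0 real) set \<Rightarrow> (nat ^ 3 \<Rightarrow> real) set"
  where "bounded_ratios d L =
    {w. (\<forall>\<alpha>. \<alpha> \<notin> simplex_pts d \<longrightarrow> w \<alpha> = 0) \<and>
        bdd_above ((\<lambda>f. \<Prod>\<alpha>\<in>simplex_pts d. ncoeff f \<alpha> powr w \<alpha>) ` L)}"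

definition std_basis :: "nat ^ 3 \<Rightarrow> (nat ^ 3 \<Rightarrow> real)"
  where "std_basis \<alpha> = (\<lambda>\<gamma>. if \<gamma> = \<alpha> then 1 else 0)"

text \<open>
  Addition in the type \<open>3\<close> is modulo 3, so \<open>i\<close>, \<open>i + 1\<close>, \<open>i + 2\<close> are its three elements.
  The formula is symmetric in \<open>j\<close> and \<open>k\<close>.
\<close>

definition ratio_gen :: "nat ^ 3 \<Rightarrow> 3 \<Rightarrow> (nat ^ 3 \<Rightarrow> real)"
  where "ratio_gen \<beta> i = (let j = i + 1; k = i + 2 in
      std_basis (\<beta> + unit_exp i + unit_exp i) + std_basis (\<beta> + unit_exp j + unit_exp k)
    - std_basis (\<beta> + unit_exp i + unit_exp j) - std_basis (\<beta> + unit_exp i + unit_exp k))"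

end

theory Submission
  imports Defs
begin

text \<open>
  Taking logarithms turns a ratio \<open>\<Prod>\<alpha>. c\<^sub>\<alpha> powr w\<^sub>\<alpha>\<close> into the pairing of
  \<open>(ln c\<^sub>\<alpha>)\<^sub>\<alpha>\<close> with \<open>w\<close>. The ratios \<open>g\<^bsub>\<beta>,i\<^esub>\<close> generate the cone because the matrix
  condition sits, up to a factor 2, between two versions of one inequality. If a positive symmetric
  3 by 3 matrix has at most one positive eigenvalue, then
  \<open>a\<^sub>i\<^sub>i a\<^sub>j\<^sub>k \<le> 2 a\<^sub>i\<^sub>j a\<^sub>i\<^sub>k\<close> (\<open>ratio_bound\<close>), so each \<open>g\<^bsub>\<beta>,i\<^esub>\<close> is a bounded
  ratio. Conversely, if \<open>a\<^sub>i\<^sub>i a\<^sub>j\<^sub>k \<le> a\<^sub>i\<^sub>j a\<^sub>i\<^sub>k\<close> for every \<open>i\<close>, then the matrix has at most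
  one positive eigenvalue (\<open>at_most_one_pos_eigenvalue\<close>). Hence whenever \<open>u\<close> is
  nonpositive on all \<open>g\<^bsub>\<beta>,i\<^esub>\<close>, the whole family \<open>c\<^sub>\<alpha> = exp (s u\<^sub>\<alpha>)\<close>, \<open>s \<ge> 0\<close>, is Lorentzian, and
  letting \<open>s\<close> grow shows that \<open>u\<close> is nonpositive on every bounded ratio
  (\<open>pairing_bounded_ratio_nonpos\<close>). By Farkas' lemma the cone of bounded ratios is then exactly
  the cone generated by the \<open>g\<^bsub>\<beta>,i\<^esub>\<close> (\<open>bounded_ratios_eq_hull\<close>).

  That none of the generators can be spared is a matter of geometry. The four points in the
  support of \<open>g\<^bsub>\<beta>,i\<^esub>\<close> form a rhombus made of two adjacent triangles of the regular triangulation
  of the simplex, and pairing with a function \<open>u\<close> measures the concavity of the piecewise linear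
  interpolation of \<open>u\<close> across the common edge. For each edge there is an explicit \<open>u\<close> that is
  strictly concave across all edges but the given one and affine across that one
  (\<open>pairing_exposing_same\<close>, \<open>pairing_exposing_other\<close>). Everything about extreme rays then holds for
  any finite family of nonzero vectors with such exposing functionals (\<open>exposed_generators\<close>).
\<close>

section \<open>Cones with exposed generators\<close>

lemma ray_scaleR:
  assumes "0 < t"
  shows "ray (t *\<^sub>R x) = ray x"
proof
  show "ray (t *\<^sub>R x) \<subseteq> ray x"
  proof
    fix y assume "y \<in> ray (t *\<^sub>R x)"
    then obtain s where s: "y = (s * t) *\<^sub>R x" "0 \<le> s" by (auto simp: ray_def)
    then have "0 \<le> s * t" using assms by simp
    then show "y \<in> ray x" unfolding ray_def using s by blast
  qed
  show "ray x \<subseteq> ray (t *\<^sub>R x)"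
  proof
    fix y assume "y \<in> ray x"
    then obtain s where "y = s *\<^sub>R x" "0 \<le> s" by (auto simp: ray_def)
    then show "y \<in> ray (t *\<^sub>R x)"
      using assms by (auto simp: ray_def intro!: exI[of _ "s / t"])
  qed
qed

lemma convex_cone_hull_finite_image:
  fixes g :: "'i \<Rightarrow> 'v::real_vector"
  assumes finite_I: "finite I"
  shows "convex_cone hull (g ` I) = {\<Sum>i\<in>I. c i *\<^sub>R g i | c. \<forall>i\<in>I. 0 \<le> c i}" (is "?K = ?C")
proof
  have "convex_cone ?C"
    unfolding convex_cone_iff
  proof (intro conjI ballI allI impI)
    show "0 \<in> ?C" by (auto intro!: exI[of _ "\<lambda>_. 0"])
  next
    fix x y assume "x \<in> ?C" "y \<in> ?C"
    then obtain c c' where "x = (\<Sum>i\<in>I. c i *\<^sub>R g i)" "y = (\<Sum>i\<in>I. c' i *\<^sub>R g i)"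
      "\<forall>i\<in>I. 0 \<le> c i" "\<forall>i\<in>I. 0 \<le> c' i" by blast
    then show "x + y \<in> ?C"
      by (intro CollectI exI[of _ "\<lambda>i. c i + c' i"]) (simp add: sum.distrib scaleR_add_left)
  next
    fix x and r :: real assume "x \<in> ?C" "0 \<le> r"
    then obtain c where "x = (\<Sum>i\<in>I. c i *\<^sub>R g i)" "\<forall>i\<in>I. 0 \<le> c i" by blast
    with \<open>0 \<le> r\<close> show "r *\<^sub>R x \<in> ?C"
      by (intro CollectI exI[of _ "\<lambda>i. r * c i"]) (simp add: scaleR_sum_right)
  qed
  moreover have "g i \<in> ?C" if "i \<in> I" for i
  proof -
    have "(\<Sum>j\<in>I. (if j = i then 1 else 0) *\<^sub>R g j) = (\<Sum>j\<in>I. if j = i then g j else 0)"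
      by (rule sum.cong) auto
    also have "\<dots> = g i" using that finite_I by simp
    finally show ?thesis by (auto intro!: exI[of _ "\<lambda>j. if j = i then 1 else 0"])
  qed
  ultimately show "?K \<subseteq> ?C"
    by (intro hull_minimal) auto
next
  show "?C \<subseteq> ?K"
  proof
    fix x assume "x \<in> ?C"
    then obtain c where x: "x = (\<Sum>i\<in>I. c i *\<^sub>R g i)" and c: "\<forall>i\<in>I. 0 \<le> c i" by blast
    have "(\<Sum>i\<in>J. c i *\<^sub>R g i) \<in> ?K" if "finite J" "J \<subseteq> I" for J
      using that
    proof (induction J rule: finite_induct)
      case empty
      then show ?case by (simp add: convex_cone_hull_contains_0)
    next
      case (insert j J)
      then have "c j *\<^sub>R g j \<in> ?K"
        using c by (intro convex_cone_hull_mul hull_inc) auto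
      then show ?case using insert by (simp add: convex_cone_hull_add)
    qed
    then show "x \<in> ?K" using x finite_I by blast
  qed
qed

text \<open>
  The functional \<open>l i\<close> separates the generator \<open>g i\<close> from all the others: among the
  generators it vanishes at \<open>g i\<close> only. On a nonnegative combination of generators it therefore
  vanishes only if every other coefficient is 0.
\<close>

locale exposed_generators =
  fixes I :: "'i set" and g :: "'i \<Rightarrow> 'v::real_vector" and l :: "'i \<Rightarrow> 'v \<Rightarrow> real"
  assumes finite_I: "finite I"
    and linear_l: "\<And>i. i \<in> I \<Longrightarrow> linear (l i)"
    and l_same: "\<And>i. i \<in> I \<Longrightarrow> l i (g i) = 0"
    and l_other: "\<And>i j. i \<in> I \<Longrightarrow> j \<in> I \<Longrightarrow> j \<noteq> i \<Longrightarrow> l i (g j) < 0"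
    and g_nonzero: "\<And>i. i \<in> I \<Longrightarrow> g i \<noteq> 0"
begin

definition K :: "'v set"
  where "K = convex_cone hull (g ` I)"

lemma convex_cone_K: "convex_cone K"
  by (simp add: K_def convex_cone_convex_cone_hull)

lemma g_in_K: "i \<in> I \<Longrightarrow> g i \<in> K"
  unfolding K_def by (auto intro: hull_inc)

lemma K_eq: "K = {\<Sum>i\<in>I. c i *\<^sub>R g i | c. \<forall>i\<in>I. 0 \<le> c i}"
  unfolding K_def by (rule convex_cone_hull_finite_image[OF finite_I])

lemma l_sum:
  assumes "i \<in> I"
  shows "l i (\<Sum>j\<in>I. c j *\<^sub>R g j) = (\<Sum>j\<in>I. c j * l i (g j))"
  by (simp add: linear_sum[OF linear_l[OF assms]] linear_cmul[OF linear_l[OF assms]])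

lemma l_nonpos: "i \<in> I \<Longrightarrow> j \<in> I \<Longrightarrow> l i (g j) \<le> 0"
  using l_same l_other by (cases "j = i") (auto intro: less_imp_le)

lemma l_nonpos_K:
  assumes "i \<in> I" "x \<in> K"
  shows "l i x \<le> 0"
proof -
  obtain c where x: "x = (\<Sum>j\<in>I. c j *\<^sub>R g j)" and c: "\<forall>j\<in>I. 0 \<le> c j"
    using assms K_eq by blast
  show ?thesis
    unfolding x l_sum[OF assms(1)]
    using c l_nonpos[OF assms(1)] by (intro sum_nonpos) (simp add: mult_nonneg_nonpos)
qed

lemma zero_set:
  assumes "i \<in> I"
  shows "{x \<in> K. l i x = 0} = ray (g i)"
proof
  show "{x \<in> K. l i x = 0} \<subseteq> ray (g i)"
  proof clarify
    fix x assume "x \<in> K" and lx: "l i x = 0"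
    then obtain c where x: "x = (\<Sum>j\<in>I. c j *\<^sub>R g j)" and c: "\<forall>j\<in>I. 0 \<le> c j"
      using K_eq by blast
    have "(\<Sum>j\<in>I. - (c j * l i (g j))) = 0"
      using lx unfolding x l_sum[OF assms] by (simp add: sum_negf)
    then have 0: "\<forall>j\<in>I. c j * l i (g j) = 0"
      using c l_nonpos[OF assms] finite_I
      by (subst (asm) sum_nonneg_eq_0_iff) (auto simp: mult_nonneg_nonpos)
    have "x = (\<Sum>j\<in>I. if j = i then c i *\<^sub>R g i else 0)"
      unfolding x using 0 l_other[OF assms] by (intro sum.cong) force+
    also have "\<dots> = c i *\<^sub>R g i" using finite_I assms by simp
    finally show "x \<in> ray (g i)" using c assms by (auto simp: ray_def)
  qed
  show "ray (g i) \<subseteq> {x \<in> K. l i x = 0}"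
    using assms linear_cmul[OF linear_l[OF assms]] l_same[OF assms]
    by (auto simp: ray_def intro: convex_cone_K convex_cone_scaleR g_in_K)
qed

lemma exposed: "i \<in> I \<Longrightarrow> exposed_ray K (ray (g i))"
  unfolding exposed_ray_def using g_nonzero linear_l l_nonpos_K zero_set by blast

text \<open>
  On a segment in \<open>K\<close> a functional that is nonpositive on \<open>K\<close> can vanish at an inner point only
  if it vanishes at both ends.
\<close>

lemma extreme:
  assumes "i \<in> I"
  shows "extreme_ray K (ray (g i))"
proof -
  have lin: "l i (x + y) = l i x + l i y" "l i (r *\<^sub>R x) = r * l i x" for x y r
    using linear_add[OF linear_l[OF assms]] linear_cmul[OF linear_l[OF assms]] by auto
  have "{x \<in> K. l i x = 0} face_of K"
    unfolding face_of_def
  proof (intro conjI ballI impI)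
    have "convex_cone {x \<in> K. l i x = 0}"
      using convex_cone_K lin linear_0[OF linear_l[OF assms]] unfolding convex_cone_iff by auto
    then show "convex {x \<in> K. l i x = 0}" by (simp add: convex_cone_def)
  next
    fix a b x assume ab: "a \<in> K" "b \<in> K" and x: "x \<in> {x \<in> K. l i x = 0}" "x \<in> open_segment a b"
    then obtain t where t: "0 < t" "t < 1" "x = (1 - t) *\<^sub>R a + t *\<^sub>R b"
      by (auto simp: in_segment)
    have "(1 - t) * l i a + t * l i b = 0" using x t lin by auto
    moreover have "(1 - t) * l i a \<le> 0" "t * l i b \<le> 0"
      using t l_nonpos_K[OF assms] ab by (auto simp: mult_nonneg_nonpos)
    ultimately have "(1 - t) * l i a = 0" "t * l i b = 0" by linarith+
    then have "l i a = 0" "l i b = 0" using t by auto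
    then show "a \<in> {x \<in> K. l i x = 0}" "b \<in> {x \<in> K. l i x = 0}" using ab by auto
  qed auto
  then show ?thesis
    unfolding extreme_ray_def zero_set[OF assms] using g_nonzero[OF assms] by blast
qed

text \<open>
  A nonzero point of an extreme ray is a nonnegative combination of the generators, and it is the
  midpoint of (twice) a generator with positive coefficient and (twice) the rest, so the generator
  lies on the ray.
\<close>

lemma extreme_ray_imp_generator:
  assumes "extreme_ray K R"
  shows "\<exists>i\<in>I. R = ray (g i)"
proof -
  obtain r where r: "r \<noteq> 0" "R = ray r" and face: "R face_of K"
    using assms by (auto simp: extreme_ray_def)
  have rR: "r \<in> R" using r by (auto simp: ray_def intro!: exI[of _ 1])
  have RK: "R \<subseteq> K" using face by (simp add: face_of_def)
  have "r \<in> K" using rR RK by blast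
  then obtain c where rsum: "r = (\<Sum>j\<in>I. c j *\<^sub>R g j)" and c: "\<forall>j\<in>I. 0 \<le> c j"
    using K_eq by blast
  have "\<exists>i\<in>I. c i \<noteq> 0"
  proof (rule ccontr)
    assume "\<not> (\<exists>i\<in>I. c i \<noteq> 0)"
    then show False using r(1) rsum by simp
  qed
  then obtain i where i: "i \<in> I" "0 < c i" using c by force
  define a where "a = (2 * c i) *\<^sub>R g i"
  define b where "b = 2 *\<^sub>R (\<Sum>j\<in>I - {i}. c j *\<^sub>R g j)"
  have r_mid: "r = (1 - 1/2) *\<^sub>R a + (1/2) *\<^sub>R b"
    unfolding a_def b_def rsum by (simp add: sum.remove[OF finite_I i(1)])
  have "a \<in> K"
    unfolding a_def using i by (intro convex_cone_scaleR[OF convex_cone_K]) (auto intro: g_in_K)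
  have "(\<Sum>j\<in>I - {i}. c j *\<^sub>R g j) = (\<Sum>j\<in>I. (if j = i then 0 else c j) *\<^sub>R g j)"
    by (simp add: sum.remove[OF finite_I i(1)])
  then have "(\<Sum>j\<in>I - {i}. c j *\<^sub>R g j) \<in> K"
    unfolding K_eq using c by (intro CollectI exI[of _ "\<lambda>j. if j = i then 0 else c j"]) auto
  then have "b \<in> K"
    unfolding b_def by (intro convex_cone_scaleR[OF convex_cone_K]) auto
  have "a \<in> R"
  proof (cases "a = b")
    case True
    then have "r = a"
      unfolding r_mid by (simp flip: scaleR_left_distrib)
    then show ?thesis using rR by simp
  next
    case False
    then have "r \<in> open_segment a b"
      using r_mid by (auto simp: in_segment intro!: exI[of _ "1/2"])
    then show ?thesis using face \<open>a \<in> K\<close> \<open>b \<in> K\<close> rR unfolding face_of_def by blast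
  qed
  then obtain t where t: "a = t *\<^sub>R r" "0 \<le> t" using r by (auto simp: ray_def)
  have "a \<noteq> 0" using i g_nonzero by (simp add: a_def)
  then have "0 < t" using t by (cases "t = 0") auto
  have "ray r = ray a" unfolding t(1) by (rule ray_scaleR[OF \<open>0 < t\<close>, symmetric])
  also have "\<dots> = ray (g i)" unfolding a_def using i by (intro ray_scaleR) simp
  finally have "ray r = ray (g i)" .
  then show ?thesis using r i by blast
qed

lemma inj_on_ray: "inj_on (\<lambda>i. ray (g i)) I"
proof (rule inj_onI)
  fix i j assume ij: "i \<in> I" "j \<in> I" "ray (g i) = ray (g j)"
  have "g j \<in> ray (g j)" by (auto simp: ray_def intro!: exI[of _ 1])
  then have "l i (g j) = 0" using ij zero_set[OF ij(1)] by auto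
  then show "i = j" using l_other ij by fastforce
qed

lemma card_extreme_rays: "card {R. extreme_ray K R} = card I"
proof -
  have "{R. extreme_ray K R} = (\<lambda>i. ray (g i)) ` I"
    using extreme extreme_ray_imp_generator by auto
  then show ?thesis by (simp add: card_image[OF inj_on_ray])
qed

text \<open>
  If \<open>g i\<close> is left out, every nonzero element of the cone that remains is strictly negative
  under \<open>l i\<close>, whereas \<open>l i (g i) = 0\<close>.
\<close>

lemma minimal_generators: "minimal_generating_set K (g ` I)"
  unfolding minimal_generating_set_def
proof (intro conjI allI impI notI)
  show "convex_cone hull (g ` I) = K" by (simp add: K_def)
next
  fix H assume H: "H \<subset> g ` I" "convex_cone hull H = K"
  then obtain i where i: "i \<in> I" "g i \<notin> H" by blast
  have lin: "l i (x + y) = l i x + l i y" "l i (r *\<^sub>R x) = r * l i x" for x y r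
    using linear_add[OF linear_l[OF i(1)]] linear_cmul[OF linear_l[OF i(1)]] by auto
  let ?C = "{x. x = 0 \<or> l i x < 0}"
  have "H \<subseteq> ?C"
  proof
    fix h assume "h \<in> H"
    then obtain j where "j \<in> I" "h = g j" "j \<noteq> i" using H i by blast
    then show "h \<in> ?C" using l_other i by auto
  qed
  moreover have "convex_cone ?C"
    unfolding convex_cone_iff
    using linear_0[OF linear_l[OF i(1)]] by (auto simp: lin mult_less_0_iff)
  ultimately have "convex_cone hull H \<subseteq> ?C" by (rule hull_minimal)
  then have "g i \<in> ?C" using H g_in_K[OF i(1)] by blast
  then show False using g_nonzero l_same i by fastforce
qed

end

section \<open>Farkas' lemma\<close>

text \<open>
  The induction removes one functional \<open>a m\<close>. If the others do not already force \<open>b \<le> 0\<close>, there is a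
  point \<open>x\<close> where they are nonpositive and \<open>b x > 0\<close>, whence \<open>a m x > 0\<close>, and \<open>x\<close> can be scaled to
  \<open>a m x = 1\<close>. Projecting along \<open>x\<close> onto the kernel of \<open>a m\<close> gives functionals to which the
  induction hypothesis applies. No topology enters, so the lemma holds in every real vector space,
  in particular in function spaces that are not Euclidean.
\<close>

lemma farkas:
  fixes a :: "'i \<Rightarrow> 'v::real_vector \<Rightarrow> real"
  assumes "finite I" "\<And>i. i \<in> I \<Longrightarrow> linear (a i)" "linear b"
    and "\<And>x. (\<forall>i\<in>I. a i x \<le> 0) \<Longrightarrow> b x \<le> 0"
  shows "\<exists>c. (\<forall>i\<in>I. 0 \<le> c i) \<and> (\<forall>x. b x = (\<Sum>i\<in>I. c i * a i x))"
  using assms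
proof (induction I arbitrary: a b rule: finite_induct)
  case empty
  have "b x = 0" for x
    using empty(3)[of x] empty(3)[of "- x"] linear_neg[OF empty(2)] by simp
  then show ?case by simp
next
  case (insert m I)
  show ?case
  proof (cases "\<forall>x. (\<forall>i\<in>I. a i x \<le> 0) \<longrightarrow> b x \<le> 0")
    case True
    have "\<exists>c. (\<forall>i\<in>I. 0 \<le> c i) \<and> (\<forall>x. b x = (\<Sum>i\<in>I. c i * a i x))"
      by (rule insert.IH) (use insert.prems True in auto)
    then obtain c where "\<forall>i\<in>I. 0 \<le> c i" "\<forall>x. b x = (\<Sum>i\<in>I. c i * a i x)" by blast
    then show ?thesis
      using insert.hyps by (intro exI[of _ "c(m := 0)"]) (auto intro!: sum.cong)
  next
    case False
    then obtain y where y: "\<forall>i\<in>I. a i y \<le> 0" "0 < b y" by force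
    then have "0 < a m y" using insert.prems(3)[of y] by force
    define x where "x = (1 / a m y) *\<^sub>R y"
    have lin: "linear (a i)" if "i \<in> insert m I" for i using insert.prems that by blast
    have amx: "a m x = 1"
      using \<open>0 < a m y\<close> linear_cmul[OF lin, of m] by (simp add: x_def)
    have aix: "a i x \<le> 0" if "i \<in> I" for i
      using that y \<open>0 < a m y\<close> linear_cmul[OF lin, of i] by (simp add: x_def divide_le_0_iff)
    have bx: "0 < b x"
      using y \<open>0 < a m y\<close> linear_cmul[OF insert.prems(2)] by (simp add: x_def)
    define a' where "a' i z = a i z - a i x * a m z" for i z
    define b' where "b' z = b z - b x * a m z" for z
    have linear_diff_mult: "linear (\<lambda>z. f z - k * a m z)" if "linear f" for f and k :: real
      using that lin[of m] by (auto simp: linear_iff algebra_simps)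
    have "\<exists>c. (\<forall>i\<in>I. 0 \<le> c i) \<and> (\<forall>z. b' z = (\<Sum>i\<in>I. c i * a' i z))"
    proof (rule insert.IH)
      show "linear (a' i)" if "i \<in> I" for i
        unfolding a'_def[abs_def] using that lin by (intro linear_diff_mult) auto
      show "linear b'"
        unfolding b'_def[abs_def] using insert.prems by (intro linear_diff_mult) auto
      fix z assume z: "\<forall>i\<in>I. a' i z \<le> 0"
      define z' where "z' = z - a m z *\<^sub>R x"
      have shift: "f z' = f z - f x * a m z" if "linear f" for f
        using linear_diff[OF that] linear_cmul[OF that] by (simp add: z'_def)
      have "b z' \<le> 0"
        using z shift[OF lin] amx by (intro insert.prems(3)) (auto simp: a'_def)
      then show "b' z \<le> 0" using shift[OF insert.prems(2)] by (simp add: b'_def)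
    qed
    then obtain c where c: "\<forall>i\<in>I. 0 \<le> c i" "\<And>z. b' z = (\<Sum>i\<in>I. c i * a' i z)" by blast
    \<comment> \<open>The corrections made by the projection add up to the coefficient of \<open>a m\<close>.\<close>
    define c0 where "c0 = b x - (\<Sum>i\<in>I. c i * a i x)"
    have "(\<Sum>i\<in>I. c i * a i x) \<le> 0"
      using c aix by (intro sum_nonpos) (simp add: mult_nonneg_nonpos)
    then have "0 \<le> c0" using bx by (simp add: c0_def)
    have b_eq: "b z = c0 * a m z + (\<Sum>i\<in>I. c i * a i z)" for z
      using c(2)[of z]
      by (simp add: a'_def b'_def c0_def algebra_simps sum_subtractf sum_distrib_left)
    have "(\<Sum>i\<in>I. (c(m := c0)) i * a i z) = (\<Sum>i\<in>I. c i * a i z)" for z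
      using insert.hyps by (intro sum.cong) auto
    then show ?thesis
      using insert.hyps c \<open>0 \<le> c0\<close> b_eq by (intro exI[of _ "c(m := c0)"]) auto
  qed
qed

section \<open>Positive symmetric 3 by 3 matrices with at most one positive eigenvalue\<close>

lemma charpoly_sym3:
  fixes A :: "real ^ 3 ^ 3"
  assumes "\<And>i j. A $ i $ j = A $ j $ i"
  shows "charpoly A =
    [: - (A$1$1 * A$2$2 * A$3$3 + 2 * A$1$2 * A$1$3 * A$2$3
          - A$1$1 * (A$2$3)\<^sup>2 - A$2$2 * (A$1$3)\<^sup>2 - A$3$3 * (A$1$2)\<^sup>2),
       (A$1$1 * A$2$2 - (A$1$2)\<^sup>2) + (A$1$1 * A$3$3 - (A$1$3)\<^sup>2) + (A$2$2 * A$3$3 - (A$2$3)\<^sup>2),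
       - (A$1$1 + A$2$2 + A$3$3), 1 :]"
  unfolding charpoly_def det_3
  by (simp add: mat_def assms[of 2 1] assms[of 3 1] assms[of 3 2] power2_eq_square algebra_simps)

lemma two_positive_roots:
  fixes A :: "real ^ 'n ^ 'n"
  assumes "charpoly A \<noteq> 0" "0 < r" "r < s" "poly (charpoly A) r = 0" "poly (charpoly A) s = 0"
  shows "2 \<le> num_pos_eigenvalues A"
proof -
  let ?M = "filter_mset (\<lambda>t. t > 0) (proots (charpoly A))"
  have "{#r, s#} \<subseteq># ?M"
    using assms by (intro mset_subset_eqI) (auto simp: order_root Suc_le_eq)
  then have "size {#r, s#} \<le> size ?M" by (rule size_mset_mono)
  then show ?thesis by (simp add: num_pos_eigenvalues_def)
qed

text \<open>
  One root lies between \<open>x\<close> and \<open>y\<close>, or is \<open>x\<close> itself, and another lies beyond \<open>y\<close>. At \<open>x = 0\<close> a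
  positive value is required because there the first root has to be positive.
\<close>

lemma poly_two_positive_roots:
  fixes P :: "real poly"
  assumes "0 < lead_coeff P" "0 \<le> x" "x < y" "poly P y < 0" "0 \<le> poly P x" "x = 0 \<Longrightarrow> 0 < poly P x"
  shows "\<exists>r s. 0 < r \<and> r < s \<and> poly P r = 0 \<and> poly P s = 0"
proof -
  obtain n where n: "\<forall>z\<ge>n. lead_coeff P \<le> poly P z"
    using poly_pinfty_gt_lc[OF assms(1)] by blast
  define z where "z = max n (y + 1)"
  have "0 < poly P z" using n assms(1) by (smt (verit) z_def)
  then obtain s where s: "y < s" "poly P s = 0"
    using poly_IVT_pos[of y z P] assms(4) unfolding z_def
    by (metis less_add_one less_max_iff_disj)
  obtain r where "0 < r" "r < y" "poly P r = 0"
  proof (cases "poly P x = 0")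
    case True
    then show ?thesis using that[of x] assms by force
  next
    case False
    then obtain r where "x < r" "r < y" "poly P r = 0"
      using poly_IVT_neg[of x y P] assms by auto
    then show ?thesis using that[of r] assms(2) by simp
  qed
  then show ?thesis using s by (intro exI[of _ r] exI[of _ s]) auto
qed

text \<open>
  The numbers \<open>\<mu>\<close> and \<open>\<nu>\<close> are the eigenvalues of the matrix with rows \<open>a, p\<close> and \<open>p, b\<close>. Since
  \<open>p\<close> is nonzero, the diagonal entries lie strictly between them.
\<close>

lemma two_by_two_eigenvalues:
  fixes a b p :: real
  assumes "0 < p"
  obtains \<mu> \<nu> where "\<mu> < a" "\<mu> < b" "a < \<nu>" "b < \<nu>"
    "(a - \<mu>) * (b - \<mu>) = p\<^sup>2" "(\<nu> - a) * (\<nu> - b) = p\<^sup>2" "\<mu> * \<nu> = a * b - p\<^sup>2"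
proof -
  define D where "D = sqrt ((a - b)\<^sup>2 + 4 * p\<^sup>2)"
  have D2: "D\<^sup>2 = (a - b)\<^sup>2 + 4 * p\<^sup>2" by (simp add: D_def)
  have "sqrt ((a - b)\<^sup>2) < D"
    unfolding D_def using assms by (intro real_sqrt_less_mono) simp
  then have "\<bar>a - b\<bar> < D" by simp
  moreover have "((a + b - D) / 2) * ((a + b + D) / 2) = a * b - p\<^sup>2"
    "(a - (a + b - D) / 2) * (b - (a + b - D) / 2) = p\<^sup>2"
    "((a + b + D) / 2 - a) * ((a + b + D) / 2 - b) = p\<^sup>2"
    using D2 by (simp_all add: field_simps power2_eq_square)
  ultimately show ?thesis
    by (intro that[of "(a + b - D) / 2" "(a + b + D) / 2"]) (auto simp: field_simps abs_less_iff)
qed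

text \<open>
  The characteristic polynomial of the symmetric matrix with diagonal \<open>a, b, c\<close> and with entries
  \<open>p, q, r\<close> at the positions 12, 13, 23. With scalar parameters, a permutation of the indices is a
  permutation of the arguments.
\<close>

definition cubic :: "real \<Rightarrow> real \<Rightarrow> real \<Rightarrow> real \<Rightarrow> real \<Rightarrow> real \<Rightarrow> real \<Rightarrow> real"
  where "cubic a b c p q r x =
    (x - a) * (x - b) * (x - c) - (x - a) * r\<^sup>2 - (x - b) * q\<^sup>2 - (x - c) * p\<^sup>2 - 2 * p * q * r"

text \<open>
  Cauchy interlacing for the leading 2 by 2 minor. At an eigenvalue of this minor the
  characteristic polynomial reduces to a binary quadratic form in \<open>q, r\<close> of vanishing
  discriminant. The form is negative at the larger eigenvalue and nonnegative at the smaller one. The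
  smaller eigenvalue is positive if and only if the minor is.
\<close>

lemma cubic_interlacing:
  assumes "0 < a" "0 < b" "0 < p" "0 < q" "0 < r"
  shows "\<exists>\<nu>>0. cubic a b c p q r \<nu> < 0 \<and>
    (p\<^sup>2 < a * b \<longrightarrow> (\<exists>\<mu>>0. \<mu> < \<nu> \<and> 0 \<le> cubic a b c p q r \<mu>))"
proof -
  obtain \<mu> \<nu> where *: "\<mu> < a" "\<mu> < b" "a < \<nu>" "b < \<nu>"
    "(a - \<mu>) * (b - \<mu>) = p\<^sup>2" "(\<nu> - a) * (\<nu> - b) = p\<^sup>2" "\<mu> * \<nu> = a * b - p\<^sup>2"
    using two_by_two_eigenvalues[OF assms(3)] by blast
  have "cubic a b c p q r \<nu>
      = (\<nu> - c) * ((\<nu> - a) * (\<nu> - b) - p\<^sup>2) - ((\<nu> - b) * q\<^sup>2 + 2 * p * q * r + (\<nu> - a) * r\<^sup>2)"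
    unfolding cubic_def by (simp add: algebra_simps)
  also have "\<dots> < 0"
  proof -
    have "0 < (\<nu> - b) * q\<^sup>2" "0 < 2 * p * q * r" "0 < (\<nu> - a) * r\<^sup>2" using * assms by auto
    then show ?thesis unfolding *(6) by simp
  qed
  finally have "cubic a b c p q r \<nu> < 0" .
  moreover have "0 \<le> cubic a b c p q r \<mu>"
  proof -
    have "cubic a b c p q r \<mu>
        = (\<mu> - c) * ((a - \<mu>) * (b - \<mu>) - p\<^sup>2) + ((b - \<mu>) * q\<^sup>2 - 2 * p * q * r + (a - \<mu>) * r\<^sup>2)"
      unfolding cubic_def by (simp add: algebra_simps)
    also have "\<dots> = (b - \<mu>) * q\<^sup>2 - 2 * p * q * r + (a - \<mu>) * r\<^sup>2" using * by simp
    finally have eq: "cubic a b c p q r \<mu> = (b - \<mu>) * q\<^sup>2 - 2 * p * q * r + (a - \<mu>) * r\<^sup>2" .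
    have "(b - \<mu>) * cubic a b c p q r \<mu>
        = ((b - \<mu>) * q)\<^sup>2 - 2 * p * r * ((b - \<mu>) * q) + ((a - \<mu>) * (b - \<mu>)) * r\<^sup>2"
      unfolding eq by (simp add: algebra_simps power2_eq_square)
    also have "\<dots> = ((b - \<mu>) * q - p * r)\<^sup>2"
      unfolding *(5) by (simp add: algebra_simps power2_eq_square)
    finally have "0 \<le> (b - \<mu>) * cubic a b c p q r \<mu>" by simp
    then show ?thesis using * by (simp add: zero_le_mult_iff)
  qed
  moreover have "0 < \<mu>" if "p\<^sup>2 < a * b"
    using that * assms by (smt (verit) mult_nonpos_nonneg)
  moreover have "0 < \<nu>" using * assms by linarith
  ultimately show ?thesis using * by (intro exI[of _ \<nu>]) auto
qed

text \<open>
  The Schur complement identity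
  \<open>(p\<^sup>2 - a b) (q\<^sup>2 - a c) - (a r - p q)\<^sup>2 = a D\<close>, where \<open>D\<close> is the determinant. The
  product on the left is at most \<open>(p q)\<^sup>2\<close>, so \<open>D \<ge> 0\<close> forces \<open>\<bar>a r - p q\<bar> \<le> p q\<close>.
\<close>

lemma ratio_bound_real:
  fixes a b c p q r :: real
  assumes "0 < a" "0 < p" "0 < q" "0 < r"
    and "a * b \<le> p\<^sup>2" "a * c \<le> q\<^sup>2" "0 < b" "0 < c"
    and D: "0 \<le> a * b * c + 2 * p * q * r - a * r\<^sup>2 - b * q\<^sup>2 - c * p\<^sup>2"
  shows "a * r \<le> 2 * p * q"
proof (rule ccontr)
  assume "\<not> a * r \<le> 2 * p * q"
  then have "p * q < a * r - p * q" by simp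
  then have "(p * q)\<^sup>2 < (a * r - p * q)\<^sup>2" using assms by (intro power_strict_mono) auto
  also have "\<dots> = (p\<^sup>2 - a * b) * (q\<^sup>2 - a * c)
      - a * (a * b * c + 2 * p * q * r - a * r\<^sup>2 - b * q\<^sup>2 - c * p\<^sup>2)"
    by (simp add: algebra_simps power2_eq_square)
  also have "\<dots> \<le> (p\<^sup>2 - a * b) * (q\<^sup>2 - a * c)" using D assms by simp
  also have "\<dots> \<le> p\<^sup>2 * q\<^sup>2" using assms by (intro mult_mono) auto
  finally show False by (simp add: power_mult_distrib)
qed

lemma forall_3_cyclic: "(\<forall>i::3. P i (i + 1) (i + 2)) \<longleftrightarrow> P 1 2 3 \<and> P 2 3 1 \<and> P 3 1 2"
proof -
  have "(2::3) + 2 = 1" "(3::3) + 1 = 1" "(3::3) + 2 = 2" "(1::3) + 1 = 2" "(1::3) + 2 = 3" "(2::3) + 1 = 3"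
    by simp_all
  then show ?thesis unfolding forall_3 by (simp only:)
qed

text \<open>
  A positive 2 by 2 principal minor or a negative determinant would give the characteristic
  polynomial two distinct positive roots: interlacing provides a positive point where the polynomial
  is negative, and to the left of it the smaller eigenvalue of the minor, respectively 0, where it is
  not. The bound follows from the signs of the minors and of the determinant.
\<close>

lemma ratio_bound:
  fixes A :: "real ^ 3 ^ 3"
  assumes sym: "\<And>i j. A $ i $ j = A $ j $ i" and pos: "\<And>i j. 0 < A $ i $ j"
    and one: "num_pos_eigenvalues A \<le> 1"
  shows "A $ i $ i * A $ (i + 1) $ (i + 2) \<le> 2 * A $ i $ (i + 1) * A $ i $ (i + 2)"
proof -
  let ?P = "charpoly A"
  define a b c p q r where abc: "a = A$1$1" "b = A$2$2" "c = A$3$3" "p = A$1$2" "q = A$1$3" "r = A$2$3"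
  have pos': "0 < a" "0 < b" "0 < c" "0 < p" "0 < q" "0 < r" using pos by (auto simp: abc)
  have P: "poly ?P x = cubic a b c p q r x" for x
    unfolding charpoly_sym3[OF sym] cubic_def abc by (simp add: algebra_simps power2_eq_square)
  have lc: "lead_coeff ?P = 1" unfolding charpoly_sym3[OF sym] by simp
  have no: False if xy: "0 \<le> x" "x < y" "poly ?P y < 0" "0 \<le> poly ?P x" "x = 0 \<Longrightarrow> 0 < poly ?P x" for x y
  proof -
    have "0 < lead_coeff ?P" using lc by simp
    then obtain r s where "0 < r" "r < s" "poly ?P r = 0" "poly ?P s = 0"
      using poly_two_positive_roots[OF _ xy] by blast
    moreover have "?P \<noteq> 0" using lc by auto
    ultimately show False using two_positive_roots[of A r s] one by auto
  qed
  have minor: "a' * b' \<le> p'\<^sup>2"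
    if swap: "cubic a b c p q r = cubic a' b' c' p' q' r'" and pos'': "0 < a'" "0 < b'" "0 < p'" "0 < q'" "0 < r'"
    for a' b' c' p' q' r'
  proof (rule ccontr)
    assume "\<not> a' * b' \<le> p'\<^sup>2"
    then obtain \<mu> \<nu> where "0 < \<mu>" "\<mu> < \<nu>" "poly ?P \<nu> < 0" "0 \<le> poly ?P \<mu>"
      using cubic_interlacing[of a' b' p' q' r' c'] pos'' unfolding P swap by auto
    then show False using no[of \<mu> \<nu>] by simp
  qed
  have perm: "cubic a b c p q r = cubic a c b q p r" "cubic a b c p q r = cubic b c a r p q"
    by (simp_all add: cubic_def fun_eq_iff algebra_simps)
  have minors: "a * b \<le> p\<^sup>2" "a * c \<le> q\<^sup>2" "b * c \<le> r\<^sup>2"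
    by (rule minor[OF refl] minor[OF perm(1)] minor[OF perm(2)]; fact pos')+
  have D: "0 \<le> a * b * c + 2 * p * q * r - a * r\<^sup>2 - b * q\<^sup>2 - c * p\<^sup>2"
  proof (rule ccontr)
    assume "\<not> ?thesis"
    then have "0 < poly ?P 0" by (simp add: P cubic_def)
    moreover obtain y where "0 < y" "poly ?P y < 0"
      using cubic_interlacing[of a b p q r c] pos' by (auto simp: P)
    ultimately show False using no[of 0 y] by simp
  qed
  have "a * r \<le> 2 * p * q"
    using pos' minors D by (intro ratio_bound_real[of a p q r b c])
  moreover have "b * q \<le> 2 * r * p"
  proof (rule ratio_bound_real[of b r p q c a])
    show "0 \<le> b * c * a + 2 * r * p * q - b * q\<^sup>2 - c * p\<^sup>2 - a * r\<^sup>2"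
      using D by (simp add: ac_simps)
  qed (use pos' minors in \<open>simp_all add: mult.commute\<close>)
  moreover have "c * p \<le> 2 * q * r"
  proof (rule ratio_bound_real[of c q r p a b])
    show "0 \<le> c * a * b + 2 * q * r * p - c * p\<^sup>2 - a * r\<^sup>2 - b * q\<^sup>2"
      using D by (simp add: ac_simps)
  qed (use pos' minors in \<open>simp_all add: mult.commute\<close>)
  ultimately have "A$1$1 * A$2$3 \<le> 2 * A$1$2 * A$1$3 \<and> A$2$2 * A$3$1 \<le> 2 * A$2$3 * A$2$1 \<and> A$3$3 * A$1$2 \<le> 2 * A$3$1 * A$3$2"
    unfolding abc sym[of 3 1] sym[of 2 1] sym[of 3 2] by auto
  then have "\<forall>i::3. A $ i $ i * A $ (i + 1) $ (i + 2) \<le> 2 * A $ i $ (i + 1) * A $ i $ (i + 2)"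
    unfolding forall_3_cyclic[of "\<lambda>i j k. A$i$i * A$j$k \<le> 2 * A$i$j * A$i$k"] .
  then show ?thesis by blast
qed

text \<open>
  A case of Descartes' rule of signs: dividing by the linear factor of a positive root \<open>t\<close> leaves
  \<open>x\<^sup>2 + v x + u\<close> with \<open>u = D / t \<ge> 0\<close> and \<open>v = (u - E) / t \<ge> 0\<close>, which has no positive root.
\<close>

lemma cubic_descartes:
  fixes T E D :: real
  assumes "E \<le> 0" "0 \<le> D"
  shows "size (filter_mset (\<lambda>t. t > 0) (proots [:- D, E, - T, 1:])) \<le> 1"
proof (cases "\<exists>t>0. poly [:- D, E, - T, 1:] t = 0")
  case False
  then have "filter_mset (\<lambda>t. t > 0) (proots [:- D, E, - T, 1:]) = {#}"
    by (auto simp: filter_mset_eq_conv set_count_proots)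
  then show ?thesis by (simp only: size_empty)
next
  case True
  then obtain t where t: "0 < t" "poly [:- D, E, - T, 1:] t = 0" by blast
  define u where "u = t\<^sup>2 - T * t + E"
  define v where "v = t - T"
  have D: "D = t * u" using t(2) by (simp add: u_def algebra_simps power2_eq_square)
  have u: "0 \<le> u" using D assms t by (simp add: zero_le_mult_iff)
  have "t * v = u - E" by (simp add: u_def v_def algebra_simps power2_eq_square)
  then have v: "0 \<le> v" using u assms t by (smt (verit) zero_le_mult_iff)
  have eq: "[:- D, E, - T, 1:] = [:- t, 1:] * [:u, v, 1:]"
    unfolding D by (simp add: u_def v_def algebra_simps power2_eq_square)
  have "proots [:- D, E, - T, 1:] = {#t#} + proots [:u, v, 1:]"
    unfolding eq by (subst proots_mult) simp_all
  moreover have "filter_mset (\<lambda>t. t > 0) (proots [:u, v, 1:]) = {#}"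
  proof -
    have "0 < poly [:u, v, 1:] s" if "0 < s" for s
      using that u v by (simp add: add_nonneg_pos)
    then show ?thesis by (fastforce simp: filter_mset_eq_conv set_count_proots)
  qed
  ultimately show ?thesis using t by simp
qed

text \<open>
  Multiplying two of the hypotheses shows that the 2 by 2 principal minors are nonpositive, so
  \<open>E \<le> 0\<close>. In terms of the ratios \<open>x = a r / (p q)\<close>, \<open>y = b q / (p r)\<close>, \<open>z = c p / (q r)\<close>, which
  lie between 0 and 1, the determinant is \<open>p q r\<close> times
  \<open>x y z + 2 - x - y - z = (1 - x) (1 - y) + (1 - z) (1 - x y) \<ge> 0\<close>. Descartes' rule does the rest.
\<close>

lemma at_most_one_pos_eigenvalue:
  fixes A :: "real ^ 3 ^ 3"
  assumes sym: "\<And>i j. A $ i $ j = A $ j $ i" and pos: "\<And>i j. 0 < A $ i $ j"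
    and le: "\<And>i. A $ i $ i * A $ (i + 1) $ (i + 2) \<le> A $ i $ (i + 1) * A $ i $ (i + 2)"
  shows "num_pos_eigenvalues A \<le> 1"
proof -
  define a b c p q r where abc: "a = A$1$1" "b = A$2$2" "c = A$3$3" "p = A$1$2" "q = A$1$3" "r = A$2$3"
  have pos': "0 < a" "0 < b" "0 < c" "0 < p" "0 < q" "0 < r" using pos by (auto simp: abc)
  have "\<forall>i. A $ i $ i * A $ (i + 1) $ (i + 2) \<le> A $ i $ (i + 1) * A $ i $ (i + 2)" using le by blast
  then have "A$1$1 * A$2$3 \<le> A$1$2 * A$1$3 \<and> A$2$2 * A$3$1 \<le> A$2$3 * A$2$1 \<and> A$3$3 * A$1$2 \<le> A$3$1 * A$3$2"
    unfolding forall_3_cyclic[of "\<lambda>i j k. A$i$i * A$j$k \<le> A$i$j * A$i$k"] .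
  then have le': "a * r \<le> p * q" "b * q \<le> r * p" "c * p \<le> q * r"
    unfolding abc sym[of 3 1] sym[of 2 1] sym[of 3 2] by auto
  have minor: "a * b \<le> p\<^sup>2" if "a * r \<le> p * q" "b * q \<le> r * p" "0 < a" "0 < b" "0 < p" "0 < q" "0 < r"
    for a b p q r :: real
  proof -
    have "(a * r) * (b * q) \<le> (p * q) * (r * p)" using that by (intro mult_mono[of "a * r"]) auto
    then have "(a * b) * (q * r) \<le> p\<^sup>2 * (q * r)" by (simp add: algebra_simps power2_eq_square)
    then show ?thesis using that by simp
  qed
  have "a * b \<le> p\<^sup>2" using minor[of a r p q b] le' pos' by simp
  moreover have "a * c \<le> q\<^sup>2" using minor[of a r q p c] le' pos' by (simp add: mult.commute)
  moreover have "b * c \<le> r\<^sup>2" using minor[of b q r p c] le' pos' by (simp add: mult.commute)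
  ultimately have E: "(a * b - p\<^sup>2) + (a * c - q\<^sup>2) + (b * c - r\<^sup>2) \<le> 0" by simp
  \<comment> \<open>The decomposition of \<open>x y z + 2 - x - y - z\<close> with denominators cleared.\<close>
  have "p * (a * b * c + 2 * p * q * r - a * r\<^sup>2 - b * q\<^sup>2 - c * p\<^sup>2)
      = (p * q - a * r) * (r * p - b * q) + (q * r - c * p) * (p\<^sup>2 - a * b)"
    by (simp add: algebra_simps power2_eq_square)
  also have "0 \<le> \<dots>"
    using le' \<open>a * b \<le> p\<^sup>2\<close> by simp
  finally have D: "0 \<le> a * b * c + 2 * p * q * r - a * r\<^sup>2 - b * q\<^sup>2 - c * p\<^sup>2"
    using pos' by (simp add: zero_le_mult_iff)
  show ?thesis
    unfolding num_pos_eigenvalues_def charpoly_sym3[OF sym]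
    using cubic_descartes[OF E D, of "a + b + c"] by (simp add: abc)
qed

section \<open>The space of exponents and the pairing\<close>

lemma sum_unit_exp: "(\<Sum>k\<in>UNIV. (\<beta> + unit_exp i + unit_exp j) $ k) = (\<Sum>k\<in>UNIV. \<beta> $ k) + 2"
  for \<beta> :: "nat ^ 3"
  by (simp add: sum.distrib axis_def)

lemma simplex_pts_add:
  assumes "2 \<le> d" "\<beta> \<in> simplex_pts (d - 2)"
  shows "\<beta> + unit_exp i + unit_exp j \<in> simplex_pts d"
  using assms sum_unit_exp[of \<beta> i j] by (simp add: simplex_pts_def)

lemma finite_simplex_pts: "finite (simplex_pts d)"
  and card_simplex_pts: "card (simplex_pts d) = (d + 2) choose 2"
proof -
  let ?S = "SIGMA a:{..d}. {..d - a}"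
  have "bij_betw (\<lambda>(a, b). vector [a, b, d - a - b]) ?S (simplex_pts d)"
  proof (rule bij_betw_byWitness[where f' = "\<lambda>\<alpha>. (\<alpha> $ 1, \<alpha> $ 2)"])
    show "\<forall>p\<in>?S. (\<lambda>\<alpha>. (\<alpha> $ 1, \<alpha> $ 2)) (case p of (a, b) \<Rightarrow> (vector [a, b, d - a - b] :: nat ^ 3)) = p"
      by (auto simp: vector_3)
    show "\<forall>\<alpha>\<in>simplex_pts d. (case (\<alpha> $ 1, \<alpha> $ 2) of (a, b) \<Rightarrow> vector [a, b, d - a - b]) = \<alpha>"
      by (auto simp: simplex_pts_def vec_eq_iff forall_3 vector_3 sum_3)
    show "(\<lambda>(a, b). vector [a, b, d - a - b]) ` ?S \<subseteq> simplex_pts d"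
      by (auto simp: simplex_pts_def vector_3 sum_3)
    show "(\<lambda>\<alpha>. (\<alpha> $ 1, \<alpha> $ 2)) ` simplex_pts d \<subseteq> ?S"
      by (auto simp: simplex_pts_def sum_3)
  qed
  then have "finite ?S = finite (simplex_pts d)" and card: "card ?S = card (simplex_pts d)"
    by (simp_all only: bij_betw_finite bij_betw_same_card)
  then show "finite (simplex_pts d)" by simp
  have "card ?S = (\<Sum>a\<le>d. Suc (d - a))" by simp
  also have "\<dots> = (\<Sum>a\<le>d. Suc a)" using sum.nat_diff_reindex[of Suc "Suc d"] by (simp add: lessThan_Suc_atMost)
  also have "\<dots> = (d + 2) choose 2" by (induction d) (simp_all add: choose_two numeral_2_eq_2)
  finally show "card (simplex_pts d) = (d + 2) choose 2" using card by simp
qed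

definition pairing :: "nat \<Rightarrow> (nat ^ 3 \<Rightarrow> real) \<Rightarrow> (nat ^ 3 \<Rightarrow> real) \<Rightarrow> real"
  where "pairing d u w = (\<Sum>\<alpha>\<in>simplex_pts d. u \<alpha> * w \<alpha>)"

lemma linear_pairing: "linear (pairing d u)" "linear (\<lambda>u. pairing d u w)"
  by (auto simp: linear_iff pairing_def scaleR_fun_def algebra_simps sum.distrib sum_distrib_left)

lemma pairing_std_basis_right: "\<alpha> \<in> simplex_pts d \<Longrightarrow> pairing d u (std_basis \<alpha>) = u \<alpha>"
  by (simp add: pairing_def std_basis_def if_distrib finite_simplex_pts cong: if_cong)

lemma pairing_std_basis_left: "\<alpha> \<in> simplex_pts d \<Longrightarrow> pairing d (std_basis \<alpha>) w = w \<alpha>"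
  using pairing_std_basis_right[of \<alpha> d w] by (simp add: pairing_def mult.commute)

lemma pairing_ratio_gen:
  assumes "2 \<le> d" "\<beta> \<in> simplex_pts (d - 2)"
  shows "pairing d u (ratio_gen \<beta> i) =
    u (\<beta> + unit_exp i + unit_exp i) + u (\<beta> + unit_exp (i + 1) + unit_exp (i + 2))
    - u (\<beta> + unit_exp i + unit_exp (i + 1)) - u (\<beta> + unit_exp i + unit_exp (i + 2))"
  unfolding ratio_gen_def Let_def
  by (simp add: linear_add[OF linear_pairing(1)] linear_diff[OF linear_pairing(1)]
      pairing_std_basis_right simplex_pts_add[OF assms] del: One_nat_def)

lemma ratio_gen_outside:
  assumes "2 \<le> d" "\<beta> \<in> simplex_pts (d - 2)" "\<alpha> \<notin> simplex_pts d"
  shows "ratio_gen \<beta> i \<alpha> = 0"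
  using assms simplex_pts_add[OF assms(1,2)]
  by (auto simp: ratio_gen_def Let_def std_basis_def)

section \<open>Bounded ratios as a cone\<close>

text \<open>
  Passing to logarithms makes the defining condition of a bounded ratio linear in \<open>w\<close>.
\<close>

lemma bounded_ratios_iff:
  "w \<in> bounded_ratios d (lorentzian_full_support d) \<longleftrightarrow>
    (\<forall>\<alpha>. \<alpha> \<notin> simplex_pts d \<longrightarrow> w \<alpha> = 0) \<and>
    (\<exists>M. \<forall>f\<in>lorentzian_full_support d. pairing d (\<lambda>\<alpha>. ln (ncoeff f \<alpha>)) w \<le> M)"
proof -
  have prod: "(\<Prod>\<alpha>\<in>simplex_pts d. ncoeff f \<alpha> powr w \<alpha>) = exp (pairing d (\<lambda>\<alpha>. ln (ncoeff f \<alpha>)) w)"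
    if "f \<in> lorentzian_full_support d" for f
  proof -
    have "ncoeff f \<alpha> \<noteq> 0" if "\<alpha> \<in> simplex_pts d" for \<alpha>
      using that \<open>f \<in> _\<close> by (fastforce simp: lorentzian_full_support_def)
    then show ?thesis
      unfolding pairing_def exp_sum[OF finite_simplex_pts]
      by (intro prod.cong) (auto simp: powr_def mult.commute)
  qed
  have "bdd_above ((\<lambda>f. \<Prod>\<alpha>\<in>simplex_pts d. ncoeff f \<alpha> powr w \<alpha>) ` lorentzian_full_support d)
    \<longleftrightarrow> (\<exists>M. \<forall>f\<in>lorentzian_full_support d. exp (pairing d (\<lambda>\<alpha>. ln (ncoeff f \<alpha>)) w) \<le> M)"
    by (auto simp: bdd_above_def prod)
  also have "\<dots> \<longleftrightarrow> (\<exists>M. \<forall>f\<in>lorentzian_full_support d. pairing d (\<lambda>\<alpha>. ln (ncoeff f \<alpha>)) w \<le> M)"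
  proof
    assume "\<exists>M. \<forall>f\<in>lorentzian_full_support d. exp (pairing d (\<lambda>\<alpha>. ln (ncoeff f \<alpha>)) w) \<le> M"
    then obtain M where M: "\<And>f. f \<in> lorentzian_full_support d \<Longrightarrow> exp (pairing d (\<lambda>\<alpha>. ln (ncoeff f \<alpha>)) w) \<le> M"
      by blast
    have "pairing d (\<lambda>\<alpha>. ln (ncoeff f \<alpha>)) w \<le> ln M" if "f \<in> lorentzian_full_support d" for f
      using M[OF that] by (metis exp_gt_zero ln_ge_iff order_less_le_trans)
    then show "\<exists>M. \<forall>f\<in>lorentzian_full_support d. pairing d (\<lambda>\<alpha>. ln (ncoeff f \<alpha>)) w \<le> M" by blast
  next
    assume "\<exists>M. \<forall>f\<in>lorentzian_full_support d. pairing d (\<lambda>\<alpha>. ln (ncoeff f \<alpha>)) w \<le> M"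
    then show "\<exists>M. \<forall>f\<in>lorentzian_full_support d. exp (pairing d (\<lambda>\<alpha>. ln (ncoeff f \<alpha>)) w) \<le> M"
      by (meson exp_le_cancel_iff)
  qed
  finally show ?thesis by (simp add: bounded_ratios_def)
qed

lemma convex_cone_bounded_ratios: "convex_cone (bounded_ratios d (lorentzian_full_support d))"
    (is "convex_cone ?K")
  unfolding convex_cone_iff
proof (intro conjI ballI allI impI)
  show "0 \<in> ?K"
    unfolding bounded_ratios_iff by (auto simp: linear_0[OF linear_pairing(1)])
next
  fix x y assume xy: "x \<in> ?K" "y \<in> ?K"
  then obtain M N where
    "\<forall>f\<in>lorentzian_full_support d. pairing d (\<lambda>\<alpha>. ln (ncoeff f \<alpha>)) x \<le> M"
    "\<forall>f\<in>lorentzian_full_support d. pairing d (\<lambda>\<alpha>. ln (ncoeff f \<alpha>)) y \<le> N"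
    unfolding bounded_ratios_iff by blast
  then have "\<forall>f\<in>lorentzian_full_support d. pairing d (\<lambda>\<alpha>. ln (ncoeff f \<alpha>)) (x + y) \<le> M + N"
    by (simp add: linear_add[OF linear_pairing(1)] add_mono)
  then show "x + y \<in> ?K" using xy unfolding bounded_ratios_iff by auto
next
  fix x :: "nat ^ 3 \<Rightarrow> real" and r :: real
  assume x: "x \<in> ?K" and r: "0 \<le> r"
  then obtain M where "\<forall>f\<in>lorentzian_full_support d. pairing d (\<lambda>\<alpha>. ln (ncoeff f \<alpha>)) x \<le> M"
    unfolding bounded_ratios_iff by blast
  then have "\<forall>f\<in>lorentzian_full_support d. pairing d (\<lambda>\<alpha>. ln (ncoeff f \<alpha>)) (r *\<^sub>R x) \<le> r * M"
    using r by (simp add: linear_cmul[OF linear_pairing(1)] mult_left_mono)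
  then show "r *\<^sub>R x \<in> ?K" using x unfolding bounded_ratios_iff by (auto simp: scaleR_fun_def)
qed

lemma index_3_distinct: "i + 1 \<noteq> i" "i + 2 \<noteq> i" "i + 1 \<noteq> i + 2" for i :: 3
  by simp_all

definition coeff_matrix :: "(nat ^ 3 \<Rightarrow> real) \<Rightarrow> nat ^ 3 \<Rightarrow> real ^ 3 ^ 3"
  where "coeff_matrix c \<beta> = (\<chi> i j. c (\<beta> + unit_exp i + unit_exp j))"

lemma coeff_matrix_sym: "coeff_matrix c \<beta> $ i $ j = coeff_matrix c \<beta> $ j $ i"
  by (simp add: coeff_matrix_def ac_simps)

lemma ratio_gen_bounded:
  assumes "2 \<le> d" "\<beta> \<in> simplex_pts (d - 2)"
  shows "ratio_gen \<beta> i \<in> bounded_ratios d (lorentzian_full_support d)"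
  unfolding bounded_ratios_iff
proof (intro conjI allI impI exI ballI)
  fix \<alpha> assume "\<alpha> \<notin> simplex_pts d"
  then show "ratio_gen \<beta> i \<alpha> = 0" using ratio_gen_outside[OF assms] by blast
next
  fix f assume f: "f \<in> lorentzian_full_support d"
  let ?A = "coeff_matrix (ncoeff f) \<beta>"
  have pos: "0 < ?A $ j $ k" for j k
    using f simplex_pts_add[OF assms] by (auto simp: lorentzian_full_support_def coeff_matrix_def)
  have "num_pos_eigenvalues ?A \<le> 1"
    using f assms(2) by (auto simp: lorentzian_full_support_def coeff_matrix_def)
  then have le: "?A $ i $ i * ?A $ (i + 1) $ (i + 2) \<le> 2 * ?A $ i $ (i + 1) * ?A $ i $ (i + 2)"
    by (intro ratio_bound coeff_matrix_sym pos)
  have "ln (?A $ i $ i) + ln (?A $ (i + 1) $ (i + 2)) = ln (?A $ i $ i * ?A $ (i + 1) $ (i + 2))"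
    using pos by (simp add: ln_mult_pos)
  also have "\<dots> \<le> ln (2 * ?A $ i $ (i + 1) * ?A $ i $ (i + 2))"
    using le pos by (subst ln_le_cancel_iff) auto
  also have "\<dots> = ln 2 + ln (?A $ i $ (i + 1)) + ln (?A $ i $ (i + 2))"
    using pos by (simp add: ln_mult_pos)
  finally show "pairing d (\<lambda>\<alpha>. ln (ncoeff f \<alpha>)) (ratio_gen \<beta> i) \<le> ln 2"
    unfolding pairing_ratio_gen[OF assms] by (simp add: coeff_matrix_def)
qed

text \<open>
  For coefficients \<open>exp (u \<alpha>)\<close> the hypothesis on \<open>u\<close> is, after exponentiation, the entrywise
  inequality in \<open>at_most_one_pos_eigenvalue\<close> for each of the matrices of the polynomial.
\<close>

lemma exp_family_lorentzian:
  assumes "2 \<le> d"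
    and u: "\<And>\<beta> i. \<beta> \<in> simplex_pts (d - 2) \<Longrightarrow> pairing d u (ratio_gen \<beta> i) \<le> 0"
  shows "\<exists>f\<in>lorentzian_full_support d. \<forall>\<alpha>\<in>simplex_pts d. ncoeff f \<alpha> = exp (u \<alpha>)"
proof -
  define h where "h \<alpha> = (if \<alpha> \<in> simplex_pts d then exp (u \<alpha>) / (\<Prod>i\<in>UNIV. fact (\<alpha> $ i)) else 0)"
    for \<alpha> :: "nat ^ 3"
  define f where "f = Abs_poly_mapping h"
  have "finite {\<alpha>. h \<alpha> \<noteq> 0}"
    by (rule finite_subset[OF _ finite_simplex_pts[of d]]) (auto simp: h_def)
  then have lookup: "Poly_Mapping.lookup f = h"
    by (simp add: f_def)
  have coeff: "ncoeff f \<alpha> = exp (u \<alpha>)" if "\<alpha> \<in> simplex_pts d" for \<alpha>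
    using that by (simp add: ncoeff_def lookup h_def)
  have "num_pos_eigenvalues (coeff_matrix (ncoeff f) \<beta>) \<le> 1" if \<beta>: "\<beta> \<in> simplex_pts (d - 2)" for \<beta>
  proof (rule at_most_one_pos_eigenvalue[OF coeff_matrix_sym])
    have A: "coeff_matrix (ncoeff f) \<beta> $ i $ j = exp (u (\<beta> + unit_exp i + unit_exp j))" for i j
      using simplex_pts_add[OF assms(1) \<beta>] by (simp add: coeff_matrix_def coeff)
    show "0 < coeff_matrix (ncoeff f) \<beta> $ i $ j" for i j by (simp add: A)
    show "coeff_matrix (ncoeff f) \<beta> $ i $ i * coeff_matrix (ncoeff f) \<beta> $ (i + 1) $ (i + 2)
      \<le> coeff_matrix (ncoeff f) \<beta> $ i $ (i + 1) * coeff_matrix (ncoeff f) \<beta> $ i $ (i + 2)" for i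
      using u[OF \<beta>, of i] unfolding A pairing_ratio_gen[OF assms(1) \<beta>]
      by (simp flip: exp_add)
  qed
  moreover have "Poly_Mapping.keys f \<subseteq> simplex_pts d"
    by (auto simp: in_keys_iff lookup h_def split: if_splits)
  ultimately have "f \<in> lorentzian_full_support d"
    by (auto simp: lorentzian_full_support_def coeff coeff_matrix_def)
  then show ?thesis using coeff by blast
qed

text \<open>
  The hypothesis on \<open>u\<close> is invariant under scaling by \<open>s \<ge> 0\<close>, so a positive value at \<open>w\<close> would make
  the ratio \<open>w\<close> unbounded along the polynomials with coefficients \<open>exp (s u\<^sub>\<alpha>)\<close>.
\<close>

lemma pairing_bounded_ratio_nonpos:
  assumes "2 \<le> d" and w: "w \<in> bounded_ratios d (lorentzian_full_support d)"
    and u: "\<And>\<beta> i. \<beta> \<in> simplex_pts (d - 2) \<Longrightarrow> pairing d u (ratio_gen \<beta> i) \<le> 0"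
  shows "pairing d u w \<le> 0"
proof (rule ccontr)
  assume "\<not> pairing d u w \<le> 0"
  then have pos: "0 < pairing d u w" by simp
  obtain M where M: "\<And>f. f \<in> lorentzian_full_support d \<Longrightarrow> pairing d (\<lambda>\<alpha>. ln (ncoeff f \<alpha>)) w \<le> M"
    using w unfolding bounded_ratios_iff by blast
  \<comment> \<open>At this scale the logarithm of the ratio is \<open>\<bar>M\<bar> + 1\<close>, which exceeds its bound \<open>M\<close>.\<close>
  define s where "s = (\<bar>M\<bar> + 1) / pairing d u w"
  have scale: "pairing d (s *\<^sub>R u) v = s * pairing d u v" for v
    using linear_cmul[OF linear_pairing(2)] by simp
  have "0 \<le> s" using pos by (simp add: s_def)
  then obtain f where f: "f \<in> lorentzian_full_support d"
    "\<forall>\<alpha>\<in>simplex_pts d. ncoeff f \<alpha> = exp ((s *\<^sub>R u) \<alpha>)"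
    using exp_family_lorentzian[OF assms(1), of "s *\<^sub>R u"] u
    by (auto simp: scale mult_nonneg_nonpos)
  have "pairing d (\<lambda>\<alpha>. ln (ncoeff f \<alpha>)) w = pairing d (s *\<^sub>R u) w"
    unfolding pairing_def using f by (intro sum.cong) auto
  then have "s * pairing d u w \<le> M" using M[OF f(1)] by (simp only: scale)
  then have "\<bar>M\<bar> + 1 \<le> M" using pos by (simp add: s_def)
  then show False by simp
qed

section \<open>The exposing functionals\<close>

text \<open>
  The term with the squares contributes \<open>-3\<close> on every rhombus. The last term, a convex function
  with a kink at \<open>\<beta>\<^sub>i + 1\<close> (truncated subtraction), raises this to \<open>-1\<close> exactly on the rhombi
  of direction \<open>i\<close> in the same strip \<open>\<beta>'\<^sub>i = \<beta>\<^sub>i\<close>. Within this strip, \<open>\<beta> + 2 e\<^sub>i\<close> is a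
  vertex only of the rhombus of \<open>\<beta>\<close>, so the point mass there raises this one to 0. Elsewhere the
  point mass adds at most 1.
\<close>

definition exposing :: "nat ^ 3 \<Rightarrow> 3 \<Rightarrow> nat ^ 3 \<Rightarrow> real"
  where "exposing \<beta> i \<alpha> = std_basis (\<beta> + unit_exp i + unit_exp i) \<alpha>
    - 3 / 2 * (\<Sum>j\<in>UNIV. (real (\<alpha> $ j))\<^sup>2) + 2 * real (\<alpha> $ i - (\<beta> $ i + 1))"

text \<open>
  On a function of one coordinate \<open>\<alpha>\<^sub>k\<close> a rhombus of direction \<open>k\<close> acts as a second difference. In
  the other two directions the values on the acute and on the obtuse vertices cancel.
\<close>

lemma pairing_coordinate:
  assumes "2 \<le> d" "\<beta> \<in> simplex_pts (d - 2)"
  shows "pairing d (\<lambda>\<alpha>. h (\<alpha> $ k)) (ratio_gen \<beta> i)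
    = (if i = k then h (\<beta> $ k + 2) + h (\<beta> $ k) - 2 * h (\<beta> $ k + 1) else 0)"
proof -
  have "k = i \<or> k = i + 1 \<or> k = i + 2"
    using exhaust_3[of k] exhaust_3[of i] by (elim disjE) simp_all
  then show ?thesis
    unfolding pairing_ratio_gen[OF assms]
    using index_3_distinct[of i] by (elim disjE) (simp_all add: axis_def)
qed

lemma pairing_square:
  assumes "2 \<le> d" "\<beta> \<in> simplex_pts (d - 2)"
  shows "pairing d (\<lambda>\<alpha>. \<Sum>j\<in>UNIV. (real (\<alpha> $ j))\<^sup>2) (ratio_gen \<beta> i) = 2"
proof -
  have "pairing d (\<lambda>\<alpha>. \<Sum>j\<in>UNIV. (real (\<alpha> $ j))\<^sup>2) (ratio_gen \<beta> i)
      = (\<Sum>j\<in>UNIV. pairing d (\<lambda>\<alpha>. (real (\<alpha> $ j))\<^sup>2) (ratio_gen \<beta> i))"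
    unfolding pairing_def sum_distrib_right by (rule sum.swap)
  also have "\<dots> = (\<Sum>j\<in>UNIV. if i = j then 2 else 0)"
    unfolding pairing_coordinate[OF assms, where h = "\<lambda>n. (real n)\<^sup>2"]
    by (intro sum.cong) (auto simp: power2_eq_square algebra_simps)
  finally show ?thesis by simp
qed

lemma pairing_hinge:
  assumes "2 \<le> d" "\<beta> \<in> simplex_pts (d - 2)"
  shows "pairing d (\<lambda>\<alpha>. real (\<alpha> $ k - (n + 1))) (ratio_gen \<beta> i) = (if i = k \<and> \<beta> $ k = n then 1 else 0)"
  unfolding pairing_coordinate[OF assms, where h = "\<lambda>m. real (m - (n + 1))"]
  by (cases "\<beta> $ k" n rule: linorder_cases) (auto simp: of_nat_diff)

text \<open>
  Only the two acute vertices have coefficient \<open>+1\<close>, and they are distinct. Of the four vertices of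
  a rhombus of direction \<open>i\<close>, only \<open>\<beta>' + 2 e\<^sub>i\<close> has \<open>i\<close>-coordinate \<open>\<beta>'\<^sub>i + 2\<close>.
\<close>

lemma pairing_point:
  assumes "2 \<le> d" "\<beta>' \<in> simplex_pts (d - 2)"
  shows "pairing d (std_basis (\<beta> + unit_exp i + unit_exp i)) (ratio_gen \<beta>' i') \<le> 1"
    "\<beta>' $ i = \<beta> $ i \<Longrightarrow> pairing d (std_basis (\<beta> + unit_exp i + unit_exp i)) (ratio_gen \<beta>' i)
       = (if \<beta>' = \<beta> then 1 else 0)"
proof -
  have ne: "\<beta>' + unit_exp i' + unit_exp i' \<noteq> \<beta>' + unit_exp (i' + 1) + unit_exp (i' + 2)"
    using index_3_distinct[of i'] by (auto simp: vec_eq_iff axis_def dest: spec[of _ i'])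
  then show "pairing d (std_basis (\<beta> + unit_exp i + unit_exp i)) (ratio_gen \<beta>' i') \<le> 1"
    unfolding pairing_ratio_gen[OF assms] by (auto simp: std_basis_def)
  assume eq: "\<beta>' $ i = \<beta> $ i"
  have "\<beta>' + unit_exp j + unit_exp k \<noteq> \<beta> + unit_exp i + unit_exp i" if "k \<noteq> i" for j k
    using that eq by (auto simp: vec_eq_iff axis_def dest!: spec[of _ i] split: if_splits)
  moreover have "\<beta>' + unit_exp i + unit_exp i = \<beta> + unit_exp i + unit_exp i \<longleftrightarrow> \<beta>' = \<beta>"
    by (simp add: vec_eq_iff)
  ultimately show "pairing d (std_basis (\<beta> + unit_exp i + unit_exp i)) (ratio_gen \<beta>' i)
       = (if \<beta>' = \<beta> then 1 else 0)"
    using index_3_distinct[of i] unfolding pairing_ratio_gen[OF assms] by (simp add: std_basis_def)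
qed

lemma pairing_exposing:
  assumes "2 \<le> d" "\<beta>' \<in> simplex_pts (d - 2)"
  shows "pairing d (exposing \<beta> i) (ratio_gen \<beta>' i') =
    pairing d (std_basis (\<beta> + unit_exp i + unit_exp i)) (ratio_gen \<beta>' i') - 3
    + 2 * (if i' = i \<and> \<beta>' $ i = \<beta> $ i then 1 else 0)"
proof -
  have "exposing \<beta> i = std_basis (\<beta> + unit_exp i + unit_exp i)
     + (-3/2) *\<^sub>R (\<lambda>\<alpha>. \<Sum>j\<in>UNIV. (real (\<alpha> $ j))\<^sup>2) + 2 *\<^sub>R (\<lambda>\<alpha>. real (\<alpha> $ i - (\<beta> $ i + 1)))"
    by (auto simp: exposing_def scaleR_fun_def)
  then show ?thesis
    by (simp only: linear_add[OF linear_pairing(2)] linear_cmul[OF linear_pairing(2)]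
       pairing_square[OF assms] pairing_hinge[OF assms])  simp
qed

lemma pairing_exposing_same:
  assumes "2 \<le> d" "\<beta> \<in> simplex_pts (d - 2)"
  shows "pairing d (exposing \<beta> i) (ratio_gen \<beta> i) = 0"
  by (simp add: pairing_exposing[OF assms] pairing_point(2)[OF assms refl] del: One_nat_def)

lemma pairing_exposing_other:
  assumes "2 \<le> d" "\<beta>' \<in> simplex_pts (d - 2)" "(\<beta>', i') \<noteq> (\<beta>, i)"
  shows "pairing d (exposing \<beta> i) (ratio_gen \<beta>' i') < 0"
proof (cases "i' = i \<and> \<beta>' $ i = \<beta> $ i")
  case True
  then show ?thesis
    using assms(3) pairing_point(2)[OF assms(1,2), of i \<beta>] by (auto simp: pairing_exposing[OF assms(1,2)])
next
  case False
  then show ?thesis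
    using pairing_point(1)[OF assms(1,2), of \<beta> i i'] by (auto simp: pairing_exposing[OF assms(1,2)])
qed

section \<open>The extreme rays\<close>

lemma ratio_gen_nonzero: "ratio_gen \<beta> i \<noteq> 0"
proof -
  have "ratio_gen \<beta> i (\<beta> + unit_exp i + unit_exp i) = 1"
    using index_3_distinct[of i]
    by (auto simp: ratio_gen_def Let_def std_basis_def vec_eq_iff axis_def dest: spec[of _ i])
  then show ?thesis by auto
qed

text \<open>
  Farkas' lemma is applied to the functionals \<open>u \<mapsto> pairing d u g\<close>, where the vectors \<open>g\<close> are the
  generators. Evaluating the resulting identity at the point masses \<open>u\<close> gives back the
  coordinates of \<open>w\<close>.
\<close>

lemma bounded_ratios_eq_hull:
  assumes "2 \<le> d"
  shows "bounded_ratios d (lorentzian_full_support d)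
    = convex_cone hull ((\<lambda>(\<beta>, i). ratio_gen \<beta> i) ` (simplex_pts (d - 2) \<times> UNIV))"
    (is "?K = convex_cone hull (?g ` ?I)")
proof
  have "finite ?I" by (simp add: finite_simplex_pts)
  show "?K \<subseteq> convex_cone hull (?g ` ?I)"
  proof
    fix w assume w: "w \<in> ?K"
    have "\<exists>c. (\<forall>p\<in>?I. 0 \<le> c p) \<and> (\<forall>u. pairing d u w = (\<Sum>p\<in>?I. c p * pairing d u (?g p)))"
    proof (rule farkas[OF \<open>finite ?I\<close> linear_pairing(2) linear_pairing(2)])
      fix u assume u: "\<forall>p\<in>?I. pairing d u (?g p) \<le> 0"
      have "pairing d u (ratio_gen \<beta> i) \<le> 0" if "\<beta> \<in> simplex_pts (d - 2)" for \<beta> i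
        using bspec[OF u, of "(\<beta>, i)"] that by simp
      then show "pairing d u w \<le> 0" by (rule pairing_bounded_ratio_nonpos[OF assms w])
    qed
    then obtain c where c: "\<forall>p\<in>?I. 0 \<le> c p"
      and cw: "\<forall>u. pairing d u w = (\<Sum>p\<in>?I. c p * pairing d u (?g p))" by (elim exE conjE)
    have sum_apply: "(\<Sum>p\<in>J. c p *\<^sub>R ?g p) \<alpha> = (\<Sum>p\<in>J. c p * ?g p \<alpha>)" for \<alpha> J
      by (induction J rule: infinite_finite_induct) (auto simp: scaleR_fun_def)
    have "w \<alpha> = (\<Sum>p\<in>?I. c p *\<^sub>R ?g p) \<alpha>" for \<alpha>
    proof (cases "\<alpha> \<in> simplex_pts d")
      case True
      then show ?thesis using cw[rule_format, of "std_basis \<alpha>"] by (simp add: pairing_std_basis_left sum_apply)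
    next
      case False
      then have "?g p \<alpha> = 0" if "p \<in> ?I" for p
        using that ratio_gen_outside[OF assms] by auto
      moreover have "w \<alpha> = 0" using w False unfolding bounded_ratios_iff by blast
      ultimately show ?thesis by (simp add: sum_apply)
    qed
    then have "w = (\<Sum>p\<in>?I. c p *\<^sub>R ?g p)" by (rule ext)
    then show "w \<in> convex_cone hull (?g ` ?I)"
      unfolding convex_cone_hull_finite_image[OF \<open>finite ?I\<close>] using c
      by (intro CollectI exI[of _ c] conjI)
  qed
  show "convex_cone hull (?g ` ?I) \<subseteq> ?K"
    using ratio_gen_bounded[OF assms]
    by (intro hull_minimal convex_cone_bounded_ratios) auto
qed

theorem theorem3p14:
  fixes d :: nat
  assumes "d \<ge> 2"
  shows "(\<forall>\<beta>\<in>simplex_pts (d - 2). \<forall>i :: 3.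
            extreme_ray (bounded_ratios d (lorentzian_full_support d)) (ray (ratio_gen \<beta> i)) \<and>
            exposed_ray (bounded_ratios d (lorentzian_full_support d)) (ray (ratio_gen \<beta> i))) \<and>
         card {R. extreme_ray (bounded_ratios d (lorentzian_full_support d)) R} = 3 * (d choose 2) \<and>
         minimal_generating_set (bounded_ratios d (lorentzian_full_support d))
           {ratio_gen \<beta> i | \<beta> i. \<beta> \<in> simplex_pts (d - 2)}"
proof -
  let ?I = "simplex_pts (d - 2) \<times> (UNIV :: 3 set)"
  let ?g = "\<lambda>(\<beta>, i). ratio_gen \<beta> i"
  interpret exposed_generators ?I ?g "\<lambda>(\<beta>, i). pairing d (exposing \<beta> i)"
  proof (rule exposed_generators.intro)
    show "finite ?I" by (simp add: finite_simplex_pts)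
    show "linear ((\<lambda>(\<beta>, i). pairing d (exposing \<beta> i)) p)" for p
      by (simp add: case_prod_beta linear_pairing(1))
  qed (use assms in \<open>auto simp: pairing_exposing_same ratio_gen_nonzero
      intro!: pairing_exposing_other\<close>)
  have K: "bounded_ratios d (lorentzian_full_support d) = K"
    unfolding K_def by (rule bounded_ratios_eq_hull[OF assms])
  have "card ?I = 3 * (d choose 2)"
    using card_simplex_pts[of "d - 2"] le_add_diff_inverse2[OF assms]
    by (simp only: card_cartesian_product) simp
  moreover have "?g ` ?I = {ratio_gen \<beta> i | \<beta> i. \<beta> \<in> simplex_pts (d - 2)}" by auto
  ultimately show ?thesis
    unfolding K using extreme exposed card_extreme_rays minimal_generators by force
qed

end
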